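(* There is no free arrangement $C\subset\mathbb{P}^2_{\mathbb{C}}$ consisting of one smooth plane quartic and two (distinct) lines all of whose singularities are nodes, tacnodes, ordinary triple intersections, singularities of type $D_{6}$, singularities of type $A_{5}$, or singularities of type $A_{7}$.
   Context: Singularity types are given by the local normal forms: $A_{k}$ ($k\geq 1$): $x^{2}+y^{k+1}=0$; $D_{k}$ ($k\geq 4$): $y^{2}x + x^{k-1}=0$. Nodes are $A_1$, tacnodes are $A_3$, ordinary triple points are $D_4$. Let $S=\mathbb{C}[x,y,z]$. For a reduced curve $C: f=0$ of degree $d$ in $\mathbb{P}^2_{\mathbb{C}}$, let $J_f$ be the ideal generated by the partial derivatives of $f$ and $M(f)=S/J_f$ the Milnor algebra. $C$ is an $m$-syzygy curve if $M(f)$ has minimal graded free resolution $$0 \rightarrow \bigoplus_{i=1}^{m-2}S(-e_{i}) \rightarrow \bigoplus_{i=1}^{m}S(1-d - d_{i}) \rightarrow S^{3}(1-d)\rightarrow S \rightarrow M(f) \rightarrow 0$$ with $e_{1} \leq \dots \leq e_{m-2}$ and $1\leq d_{1} \leq \dots \leq d_{m}$. $C$ is free if $m=2$ and $d_1+d_2=d-1$. An arrangement of curves is called free if the reduced curve that is the union of its members is free. *)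

theory Defs
  imports
    "HOL-Analysis.Product_Vector"
    "HOL-Computational_Algebra.Squarefree"
    "Jordan_Normal_Form.Matrix_Kernel"
begin

section \<open>Forms in three variables\<close>

text \<open>
  The ring \<open>S = \<complex>[x,y,z]\<close> is represented as \<open>\<complex>[x][y][z]\<close>: the innermost variable is \<open>x\<close>, and the
  coefficient of \<open>x\<^sup>i y\<^sup>j z\<^sup>k\<close> in \<open>f\<close> is \<open>coeff (coeff (coeff f k) j) i\<close>.
\<close>

type_synonym form = "complex poly poly poly"

definition coeff3 :: "form \<Rightarrow> nat \<Rightarrow> nat \<Rightarrow> nat \<Rightarrow> complex" where
  "coeff3 f i j k = coeff (coeff (coeff f k) j) i"

definition eval3 :: "form \<Rightarrow> complex vec \<Rightarrow> complex" where
  "eval3 f P = poly (poly (poly f [:[:P $ 2:]:]) [:P $ 1:]) (P $ 0)"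

definition partial_x :: "form \<Rightarrow> form" where
  "partial_x f = map_poly (map_poly pderiv) f"

definition partial_y :: "form \<Rightarrow> form" where
  "partial_y f = map_poly pderiv f"

definition partial_z :: "form \<Rightarrow> form" where
  "partial_z f = pderiv f"

text \<open>The zero form is homogeneous of every degree, and the only one of negative degree.\<close>

definition homogeneous :: "int \<Rightarrow> form \<Rightarrow> bool" where
  "homogeneous d f \<longleftrightarrow> (\<forall>i j k. coeff3 f i j k \<noteq> 0 \<longrightarrow> int (i + j + k) = d)"

section \<open>Plane curves\<close>

text \<open>
  A plane curve is given by a defining form, unique up to a nonzero constant. The union of curves
  without common component is defined by the product of their forms. Points of the projective
  plane are represented by their nonzero vectors of homogeneous coordinates; every notion below
  is invariant under rescaling of these.
\<close>

definition plane_curve :: "nat \<Rightarrow> form \<Rightarrow> bool" where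
  "plane_curve d f \<longleftrightarrow> d \<ge> 1 \<and> f \<noteq> 0 \<and> homogeneous (int d) f"

definition reduced_plane_curve :: "nat \<Rightarrow> form \<Rightarrow> bool" where
  "reduced_plane_curve d f \<longleftrightarrow> plane_curve d f \<and> squarefree f"

definition proj_points :: "complex vec set" where
  "proj_points = {P \<in> carrier_vec 3. P \<noteq> 0\<^sub>v 3}"

definition curve_points :: "form \<Rightarrow> complex vec set" where
  "curve_points f = {P \<in> proj_points. eval3 f P = 0}"

definition singular_points :: "form \<Rightarrow> complex vec set" where
  "singular_points f = {P \<in> curve_points f.
     eval3 (partial_x f) P = 0 \<and> eval3 (partial_y f) P = 0 \<and> eval3 (partial_z f) P = 0}"

definition smooth_plane_curve :: "nat \<Rightarrow> form \<Rightarrow> bool" where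
  "smooth_plane_curve d f \<longleftrightarrow> plane_curve d f \<and> singular_points f = {}"

definition plane_line :: "form \<Rightarrow> bool" where
  "plane_line l \<longleftrightarrow> plane_curve 1 l"

section \<open>Singularity types\<close>

definition holomorphic2_on :: "(complex \<times> complex \<Rightarrow> complex) \<Rightarrow> (complex \<times> complex) set \<Rightarrow> bool" where
  "holomorphic2_on g U \<longleftrightarrow>
     (\<forall>p\<in>U. \<exists>a b. (g has_derivative (\<lambda>(h, k). a * h + b * k)) (at p))"

definition biholomorphic_between ::
    "(complex \<times> complex \<Rightarrow> complex \<times> complex) \<Rightarrow> (complex \<times> complex) set \<Rightarrow> (complex \<times> complex) set \<Rightarrow> bool" where
  "biholomorphic_between \<phi> V U \<longleftrightarrow>
     open V \<and> open U \<and> bij_betw \<phi> V U \<and>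
     holomorphic2_on (fst \<circ> \<phi>) V \<and> holomorphic2_on (snd \<circ> \<phi>) V \<and>
     holomorphic2_on (fst \<circ> the_inv_into V \<phi>) U \<and> holomorphic2_on (snd \<circ> the_inv_into V \<phi>) U"

text \<open>
  The germs at the origin of the curves \<open>g = 0\<close> and \<open>h = 0\<close> are isomorphic: a local biholomorphism
  fixing the origin carries one to the other, that is, the local equations correspond up to a
  nowhere vanishing holomorphic factor \<open>u\<close>.
\<close>

definition equivalent_curve_germs ::
    "(complex \<times> complex \<Rightarrow> complex) \<Rightarrow> (complex \<times> complex \<Rightarrow> complex) \<Rightarrow> bool" where
  "equivalent_curve_germs g h \<longleftrightarrow>
     (\<exists>V U \<phi> u. biholomorphic_between \<phi> V U \<and> (0, 0) \<in> V \<and> \<phi> (0, 0) = (0, 0) \<and>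
        holomorphic2_on u V \<and> (\<forall>p\<in>V. u p \<noteq> 0 \<and> g (\<phi> p) = u p * h p))"

text \<open>
  If \<open>P, v, w\<close> is a basis of \<open>\<complex>\<^sup>3\<close>, then \<open>(s,t) \<mapsto> P + s v + t w\<close> is an affine chart of the
  projective plane centred at \<open>P\<close>. Hence the function below is a local equation of \<open>f = 0\<close> at \<open>P\<close>;
  its equivalence class does not depend on the chosen chart.
\<close>

definition affine_equation :: "form \<Rightarrow> complex vec \<Rightarrow> complex vec \<Rightarrow> complex vec \<Rightarrow> complex \<times> complex \<Rightarrow> complex" where
  "affine_equation f P v w = (\<lambda>(s, t). eval3 f (P + s \<cdot>\<^sub>v v + t \<cdot>\<^sub>v w))"

definition has_germ_type :: "form \<Rightarrow> complex vec \<Rightarrow> (complex \<times> complex \<Rightarrow> complex) \<Rightarrow> bool" where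
  "has_germ_type f P h \<longleftrightarrow>
     (\<exists>v\<in>carrier_vec 3. \<exists>w\<in>carrier_vec 3. det (mat_of_cols 3 [P, v, w]) \<noteq> 0 \<and>
        equivalent_curve_germs (affine_equation f P v w) h)"

definition A_singularity :: "nat \<Rightarrow> form \<Rightarrow> complex vec \<Rightarrow> bool" where
  "A_singularity k f P \<longleftrightarrow> k \<ge> 1 \<and> has_germ_type f P (\<lambda>(x, y). x ^ 2 + y ^ (k + 1))"

definition D_singularity :: "nat \<Rightarrow> form \<Rightarrow> complex vec \<Rightarrow> bool" where
  "D_singularity k f P \<longleftrightarrow> k \<ge> 4 \<and> has_germ_type f P (\<lambda>(x, y). y ^ 2 * x + x ^ (k - 1))"

definition node :: "form \<Rightarrow> complex vec \<Rightarrow> bool" where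
  "node f P \<longleftrightarrow> A_singularity 1 f P"

definition tacnode :: "form \<Rightarrow> complex vec \<Rightarrow> bool" where
  "tacnode f P \<longleftrightarrow> A_singularity 3 f P"

definition ordinary_triple_point :: "form \<Rightarrow> complex vec \<Rightarrow> bool" where
  "ordinary_triple_point f P \<longleftrightarrow> D_singularity 4 f P"

section \<open>Resolutions of the Milnor algebra and freeness\<close>

definition jacobian_ideal :: "form \<Rightarrow> form set" where
  "jacobian_ideal f = {a * partial_x f + b * partial_y f + c * partial_z f | a b c. True}"

text \<open>
  A graded homomorphism of degree zero from \<open>\<Oplus>\<^sub>j S(-b\<^sub>j)\<close> to \<open>\<Oplus>\<^sub>i S(-a\<^sub>i)\<close>, acting on column vectors.
\<close>

definition graded_hom :: "int list \<Rightarrow> int list \<Rightarrow> form mat \<Rightarrow> bool" where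
  "graded_hom b a A \<longleftrightarrow> A \<in> carrier_mat (length a) (length b) \<and>
     (\<forall>i<length a. \<forall>j<length b. homogeneous (b ! j - a ! i) (A $$ (i, j)))"

definition mat_image :: "form mat \<Rightarrow> form vec set" where
  "mat_image A = {A *\<^sub>v v | v. v \<in> carrier_vec (dim_col A)}"

text \<open>All entries lie in the ideal generated by \<open>x, y, z\<close>.\<close>

definition minimal_mat :: "form mat \<Rightarrow> bool" where
  "minimal_mat A \<longleftrightarrow> (\<forall>i<dim_row A. \<forall>j<dim_col A. coeff3 (A $$ (i, j)) 0 0 0 = 0)"

text \<open>
  A minimal graded free resolution
  \<open>0 \<rightarrow> \<Oplus> S(-c\<^sub>k) \<rightarrow> \<Oplus> S(-b\<^sub>j) \<rightarrow> \<Oplus> S(-a\<^sub>i) \<rightarrow> S \<rightarrow> S/I \<rightarrow> 0\<close> with differentials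
  \<open>D3, D2, D1\<close>, where \<open>S \<rightarrow> S/I\<close> is the canonical projection.
\<close>

definition minimal_graded_resolution ::
    "form set \<Rightarrow> int list \<Rightarrow> int list \<Rightarrow> int list \<Rightarrow> form mat \<Rightarrow> form mat \<Rightarrow> form mat \<Rightarrow> bool" where
  "minimal_graded_resolution I a b c D1 D2 D3 \<longleftrightarrow>
     graded_hom a [0] D1 \<and> graded_hom b a D2 \<and> graded_hom c b D3 \<and>
     mat_image D1 = {vec 1 (\<lambda>_. g) | g. g \<in> I} \<and>
     mat_image D2 = mat_kernel D1 \<and>
     mat_image D3 = mat_kernel D2 \<and>
     mat_kernel D3 = {0\<^sub>v (length c)} \<and>
     minimal_mat D1 \<and> minimal_mat D2 \<and> minimal_mat D3"

text \<open>
  The degree \<open>d\<close> curve \<open>f = 0\<close> is an \<open>m\<close>-syzygy curve with exponents \<open>ds = [d\<^sub>1, \<dots>, d\<^sub>m]\<close>.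
  Note \<open>S(1 - d - d\<^sub>j) = S(-(d - 1 + d\<^sub>j))\<close>.
\<close>

definition syzygy_curve :: "nat \<Rightarrow> form \<Rightarrow> nat \<Rightarrow> nat list \<Rightarrow> bool" where
  "syzygy_curve d f m ds \<longleftrightarrow>
     reduced_plane_curve d f \<and> m \<ge> 2 \<and> length ds = m \<and> sorted ds \<and> (\<forall>e\<in>set ds. e \<ge> 1) \<and>
     (\<exists>es D1 D2 D3. length es = m - 2 \<and> sorted es \<and>
        minimal_graded_resolution (jacobian_ideal f)
          (replicate 3 (int d - 1)) (map (\<lambda>e. int d - 1 + int e) ds) es D1 D2 D3)"

definition free_curve :: "form \<Rightarrow> bool" where
  "free_curve f \<longleftrightarrow> (\<exists>d d1 d2. syzygy_curve d f 2 [d1, d2] \<and> int d1 + int d2 = int d - 1)"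

end

theory Submission
  imports Defs "HOL-Computational_Algebra.Fundamental_Theorem_Algebra"
    "HOL-Computational_Algebra.Field_as_Ring"
begin

text \<open>
  A free sextic has exponents \<open>d\<^sub>1 + d\<^sub>2 = 5\<close>, so its form \<open>f = q l\<^sub>1 l\<^sub>2\<close> is killed by a nonzero
  derivation \<open>D = a \<partial>\<^sub>x + b \<partial>\<^sub>y + c \<partial>\<^sub>z\<close> with coefficients of degree at most 2. As \<open>q\<close> is prime to
  \<open>l\<^sub>1 l\<^sub>2\<close>, it divides \<open>D q\<close>, say \<open>D q = h q\<close>, and with the Euler derivation \<open>E\<close> the derivation
  \<open>4 D - h E\<close> kills \<open>q\<close>. Since \<open>q\<close> is smooth, its partial derivatives are three cubics without
  common zero, hence a regular sequence, whose syzygies are the Koszul ones and have degree at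
  least 3. So \<open>4 D = h E\<close>, and \<open>0 = 4 D f = 6 h f\<close> gives \<open>h = 0\<close> and \<open>D = 0\<close>.
\<close>

section \<open>Forms and their derivatives\<close>

text \<open>Lets derivations climb through the nested polynomial rings: a derivation applied to all
  coefficients is again one, because it is additive on the convolution that defines the coefficients
  of a product. \<open>partial_x\<close> needs this twice.\<close>

lemma map_poly_derivation:
  fixes \<delta> :: "'a::comm_ring_1 \<Rightarrow> 'a"
  assumes add: "\<And>a b. \<delta> (a + b) = \<delta> a + \<delta> b"
    and mult: "\<And>a b. \<delta> (a * b) = \<delta> a * b + a * \<delta> b"
  shows "map_poly \<delta> (p + q) = map_poly \<delta> p + map_poly \<delta> q"
    and "map_poly \<delta> (p * q) = map_poly \<delta> p * q + p * map_poly \<delta> q"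
proof -
  have zero: "\<delta> 0 = 0"
    using add[of 0 0] by simp
  have sum: "\<delta> (sum g A) = (\<Sum>i\<in>A. \<delta> (g i))" for g :: "nat \<Rightarrow> 'a" and A
    by (induction A rule: infinite_finite_induct) (simp_all add: zero add)
  show "map_poly \<delta> (p + q) = map_poly \<delta> p + map_poly \<delta> q"
    by (simp add: poly_eq_iff coeff_map_poly zero add)
  show "map_poly \<delta> (p * q) = map_poly \<delta> p * q + p * map_poly \<delta> q"
    by (simp add: poly_eq_iff coeff_map_poly zero coeff_mult sum mult sum.distrib)
qed

lemma partial_mult:
  "partial_x (f * g) = partial_x f * g + f * partial_x g"
  "partial_y (f * g) = partial_y f * g + f * partial_y g"
  "partial_z (f * g) = partial_z f * g + f * partial_z g"
proof -
  have d: "pderiv (p * q) = pderiv p * q + p * pderiv q" for p q :: "'a::idom poly"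
    by (simp add: pderiv_mult)
  note y = map_poly_derivation[OF pderiv_add d]
  show "partial_y (f * g) = partial_y f * g + f * partial_y g"
    unfolding partial_y_def by (rule y)
  show "partial_x (f * g) = partial_x f * g + f * partial_x g"
    unfolding partial_x_def by (rule map_poly_derivation[OF y])
  show "partial_z (f * g) = partial_z f * g + f * partial_z g"
    unfolding partial_z_def by (rule d)
qed

lemma form_eqI:
  assumes "\<And>i j k. coeff3 f i j k = coeff3 g i j k"
  shows "f = g"
  using assms unfolding coeff3_def by (simp add: poly_eq_iff)

lemma coeff3_simps [simp]:
  "coeff3 0 i j k = 0"
  "coeff3 (f + g) i j k = coeff3 f i j k + coeff3 g i j k"
  "coeff3 (f - g) i j k = coeff3 f i j k - coeff3 g i j k"
  "coeff3 (- f) i j k = - coeff3 f i j k"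
  by (simp_all add: coeff3_def)

lemma coeff3_mult:
  "coeff3 (f * g) i j k =
     (\<Sum>c\<le>k. \<Sum>b\<le>j. \<Sum>a\<le>i. coeff3 f a b c * coeff3 g (i - a) (j - b) (k - c))"
  by (simp add: coeff3_def coeff_mult coeff_sum)

section \<open>Homogeneity as an eigenvalue condition under dilation\<close>

definition const3 :: "complex \<Rightarrow> form" where
  "const3 c = [:[:[:c:]:]:]"

lemma coeff3_const3_mult [simp]: "coeff3 (const3 c * f) i j k = c * coeff3 f i j k"
  by (simp add: coeff3_def const3_def)

lemma const3_simps:
  "const3 0 = 0" "const3 1 = 1" "const3 (a + b) = const3 a + const3 b"
  "const3 (a - b) = const3 a - const3 b" "const3 (a * b) = const3 a * const3 b"
  by (simp_all add: const3_def one_pCons)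

lemma const3_eq_0_iff [simp]: "const3 c = 0 \<longleftrightarrow> c = 0"
  by (simp add: const3_def)

text \<open>
  As the powers of 2 are distinct, homogeneous forms are the eigenvectors of this ring
  endomorphism; so degrees of products and quotients can be computed without coefficients.
\<close>

definition dilate :: "form \<Rightarrow> form" where
  "dilate f = pcompose (map_poly (\<lambda>p. pcompose (map_poly (\<lambda>q. pcompose q [:0, 2:]) p) [:0, 2:]) f) [:0, 2:]"

lemma coeff3_dilate [simp]: "coeff3 (dilate f) i j k = 2 ^ (i + j + k) * coeff3 f i j k"
proof -
  have 2: "(2::'a::comm_ring_1 poly) ^ n * p = smult (2 ^ n) p" for n p
    by (induction n) (simp_all add: numeral_poly mult.assoc)
  show ?thesis
    by (simp add: coeff3_def dilate_def coeff_pcompose_linear coeff_map_poly 2 power_add)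
qed

lemma dilate_add: "dilate (f + g) = dilate f + dilate g"
  by (rule form_eqI) (simp add: algebra_simps)

lemma dilate_mult: "dilate (f * g) = dilate f * dilate g"
proof (rule form_eqI)
  fix i j k
  have eq: "coeff3 (dilate f) a b c * coeff3 (dilate g) (i - a) (j - b) (k - c) =
      2 ^ (i + j + k) * (coeff3 f a b c * coeff3 g (i - a) (j - b) (k - c))"
    if "a \<le> i" "b \<le> j" "c \<le> k" for a b c
  proof -
    have "i + j + k = (a + b + c) + ((i - a) + (j - b) + (k - c))"
      using that by simp
    then have "(2::complex) ^ (i + j + k) = 2 ^ (a + b + c) * 2 ^ ((i - a) + (j - b) + (k - c))"
      by (simp only: power_add)
    then show ?thesis
      by (simp only: coeff3_dilate mult_ac)
  qed
  have "coeff3 (dilate f * dilate g) i j k =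
     (\<Sum>c\<le>k. \<Sum>b\<le>j. \<Sum>a\<le>i. 2 ^ (i + j + k) * (coeff3 f a b c * coeff3 g (i - a) (j - b) (k - c)))"
    unfolding coeff3_mult by (intro sum.cong refl) (rule eq, simp_all only: atMost_iff)
  also have "\<dots> = 2 ^ (i + j + k) * coeff3 (f * g) i j k"
    by (simp only: coeff3_mult sum_distrib_left)
  finally show "coeff3 (dilate (f * g)) i j k = coeff3 (dilate f * dilate g) i j k"
    by (simp only: coeff3_dilate)
qed

lemma homogeneous_iff_dilate:
  "homogeneous d f \<longleftrightarrow> dilate f = const3 (2 powi d) * f"
proof
  assume "homogeneous d f"
  then show "dilate f = const3 (2 powi d) * f"
    by (intro form_eqI) (auto simp: homogeneous_def power_int_of_nat simp flip: power_int_of_nat)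
next
  assume *: "dilate f = const3 (2 powi d) * f"
  show "homogeneous d f"
    unfolding homogeneous_def
  proof (intro allI impI)
    fix i j k assume "coeff3 f i j k \<noteq> 0"
    with arg_cong[OF *, of "\<lambda>g. coeff3 g i j k"] have "(2::complex) ^ (i + j + k) = 2 powi d"
      by simp
    then have "(2::complex) powi (int (i + j + k)) = 2 powi d"
      by (simp only: power_int_of_nat)
    \<comment> \<open>Norms move the comparison to the reals, where powers of 2 are strictly
      increasing in the exponent.\<close>
    then have "norm ((2::complex) powi (int (i + j + k))) = norm ((2::complex) powi d)"
      by simp
    then have "(2::real) powi (int (i + j + k)) = 2 powi d"
      unfolding norm_power_int by simp
    then show "int (i + j + k) = d"
      by (metis one_less_numeral_iff power_int_strict_increasing linorder_neqE less_irrefl semiring_norm(76))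
  qed
qed

lemma homogeneous_0 [simp]: "homogeneous d 0"
  by (simp add: homogeneous_def)

lemma homogeneous_coeff_0:
  assumes "homogeneous (int n) f" "i + j + k \<noteq> n"
  shows "coeff3 f i j k = 0"
proof (rule ccontr)
  assume "coeff3 f i j k \<noteq> 0"
  with assms(1) have "int (i + j + k) = int n"
    unfolding homogeneous_def by blast
  with assms(2) show False
    by (simp only: of_nat_eq_iff)
qed

lemma homogeneous_const3: "homogeneous 0 (const3 c)"
  unfolding homogeneous_def const3_def coeff3_def by (auto simp: coeff_pCons split: nat.splits)

lemma homogeneous_add:
  "homogeneous d f \<Longrightarrow> homogeneous d g \<Longrightarrow> homogeneous d (f + g)"
  by (simp add: homogeneous_iff_dilate dilate_add ring_distribs)

lemma homogeneous_uminus: "homogeneous d f \<Longrightarrow> homogeneous d (- f)"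
  by (simp add: homogeneous_def)

lemma homogeneous_diff:
  "homogeneous d f \<Longrightarrow> homogeneous d g \<Longrightarrow> homogeneous d (f - g)"
  using homogeneous_add[of d f "- g"] homogeneous_uminus by simp

lemma homogeneous_mult:
  "homogeneous d f \<Longrightarrow> homogeneous e g \<Longrightarrow> homogeneous (d + e) (f * g)"
  by (simp add: homogeneous_iff_dilate dilate_mult power_int_add const3_simps mult_ac)

lemma homogeneous_power:
  "homogeneous d f \<Longrightarrow> homogeneous (int n * d) (f ^ n)"
proof (induction n)
  case 0
  then show ?case using homogeneous_const3[of 1] by (simp add: const3_simps)
next
  case (Suc n)
  then show ?case using homogeneous_mult[of d f "int n * d" "f ^ n"] by (simp add: algebra_simps)
qed

text \<open>Dilating \<open>u * f\<close> and cancelling \<open>f\<close>, which is no zero divisor,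
  leaves \<open>u\<close> as an eigenvector for the quotient of the two eigenvalues.\<close>

lemma homogeneous_factor:
  assumes "homogeneous d (u * f)" "homogeneous e f" "f \<noteq> 0"
  shows "homogeneous (d - e) u"
proof -
  have "const3 (2 powi e) * dilate u * f = const3 (2 powi d) * u * f"
    using assms(1,2) by (simp add: homogeneous_iff_dilate dilate_mult mult_ac)
  then have "const3 (2 powi e) * dilate u = const3 (2 powi d) * u"
    using assms(3) by simp
  then have "const3 (2 powi (-e)) * (const3 (2 powi e) * dilate u) = const3 (2 powi (-e)) * (const3 (2 powi d) * u)"
    by simp
  then have "const3 (2 powi (-e) * 2 powi e) * dilate u = const3 (2 powi (-e) * 2 powi d) * u"
    by (simp only: const3_simps mult.assoc)
  then show ?thesis
    by (simp add: homogeneous_iff_dilate const3_simps flip: power_int_add)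
qed

lemma homogeneous_unique_degree:
  assumes "homogeneous d f" "homogeneous e f" "f \<noteq> 0"
  shows "d = e"
  using assms form_eqI[of f 0] unfolding homogeneous_def by force

section \<open>The variables, the partial derivatives and Euler's identity\<close>

definition X3 :: form where "X3 = [:[:[:0, 1:]:]:]"
definition Y3 :: form where "Y3 = [:[:0, 1:]:]"
definition Z3 :: form where "Z3 = [:0, 1:]"

lemma homogeneous_variables: "homogeneous 1 X3" "homogeneous 1 Y3" "homogeneous 1 Z3"
  by (auto simp: homogeneous_def X3_def Y3_def Z3_def coeff3_def coeff_pCons split: nat.splits)

lemma coeff3_partial:
  "coeff3 (partial_x f) i j k = of_nat (Suc i) * coeff3 f (Suc i) j k"
  "coeff3 (partial_y f) i j k = of_nat (Suc j) * coeff3 f i (Suc j) k"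
  "coeff3 (partial_z f) i j k = of_nat (Suc k) * coeff3 f i j (Suc k)"
  by (simp_all add: coeff3_def partial_x_def partial_y_def partial_z_def coeff_map_poly coeff_pderiv
    of_nat_poly del: of_nat_Suc)

lemma homogeneous_partial:
  assumes "homogeneous d f"
  shows "homogeneous (d - 1) (partial_x f)" "homogeneous (d - 1) (partial_y f)"
    "homogeneous (d - 1) (partial_z f)"
  using assms unfolding homogeneous_def by (fastforce simp: coeff3_partial simp del: of_nat_Suc)+

lemma euler_identity:
  assumes "homogeneous (int d) f"
  shows "X3 * partial_x f + Y3 * partial_y f + Z3 * partial_z f = const3 (of_nat d) * f"
proof (rule form_eqI)
  fix i j k
  have "coeff3 (X3 * partial_x f) i j k = of_nat i * coeff3 f i j k"
    by (cases i) (simp_all add: coeff3_partial(1)[unfolded coeff3_def] coeff3_def X3_def coeff_pCons)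
  moreover have "coeff3 (Y3 * partial_y f) i j k = of_nat j * coeff3 f i j k"
    by (cases j) (simp_all add: coeff3_partial(2)[unfolded coeff3_def] coeff3_def Y3_def coeff_pCons)
  moreover have "coeff3 (Z3 * partial_z f) i j k = of_nat k * coeff3 f i j k"
    by (cases k) (simp_all add: coeff3_partial(3)[unfolded coeff3_def] coeff3_def Z3_def coeff_pCons)
  ultimately show "coeff3 (X3 * partial_x f + Y3 * partial_y f + Z3 * partial_z f) i j k = coeff3 (const3 (of_nat d) * f) i j k"
    using assms unfolding homogeneous_def by (cases "coeff3 f i j k = 0") (auto simp flip: distrib_right of_nat_add)
qed

text \<open>A coefficient of the product only sees coefficients of \<open>f\<close> of total degree
  at most \<open>i + j + k\<close>, and these vanish.\<close>

lemma coeff3_mult_below: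
  assumes "homogeneous (int n) f" "i + j + k < n"
  shows "coeff3 (m * f) i j k = 0"
proof -
  have "coeff3 f (i - a) (j - b) (k - c) = 0" for a b c
    using assms(2) by (intro homogeneous_coeff_0[OF assms(1)]) linarith
  then show ?thesis by (simp add: coeff3_mult)
qed

text \<open>In degree \<open>n\<close> the factor \<open>f\<close> already uses up the whole degree,
  so only the constant term of \<open>m\<close> can contribute.\<close>

lemma coeff3_mult_at:
  assumes "homogeneous (int n) f" "i + j + k = n"
  shows "coeff3 (m * f) i j k = coeff3 m 0 0 0 * coeff3 f i j k"
proof -
  let ?m = "m - const3 (coeff3 m 0 0 0)"
  have "coeff3 ?m a b c * coeff3 f (i - a) (j - b) (k - c) = 0" if "a \<le> i" "b \<le> j" "c \<le> k" for a b c
  proof (cases "a = 0 \<and> b = 0 \<and> c = 0")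
    case True
    then show ?thesis by (simp add: const3_def coeff3_def)
  next
    case False
    then have "(i - a) + (j - b) + (k - c) \<noteq> n"
      using assms(2) that by linarith
    from homogeneous_coeff_0[OF assms(1) this] show ?thesis
      by simp
  qed
  then have "coeff3 (?m * f) i j k = 0"
    unfolding coeff3_mult by (intro sum.neutral ballI) simp
  then show ?thesis
    by (simp add: left_diff_distrib)
qed

section \<open>The Nullstellensatz in two variables\<close>

definition is_ideal :: "'a::comm_ring_1 set \<Rightarrow> bool" where
  "is_ideal J \<longleftrightarrow> 0 \<in> J \<and> (\<forall>a\<in>J. \<forall>b\<in>J. a + b \<in> J) \<and> (\<forall>a\<in>J. \<forall>r. r * a \<in> J)"

lemma is_idealD:
  assumes "is_ideal J"
  shows "0 \<in> J" "a \<in> J \<Longrightarrow> b \<in> J \<Longrightarrow> a + b \<in> J" "a \<in> J \<Longrightarrow> r * a \<in> J"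
    "a \<in> J \<Longrightarrow> b \<in> J \<Longrightarrow> a - b \<in> J"
proof -
  show 1: "0 \<in> J" "a \<in> J \<Longrightarrow> b \<in> J \<Longrightarrow> a + b \<in> J" "a \<in> J \<Longrightarrow> r * a \<in> J" for a b r
    using assms unfolding is_ideal_def by blast+
  show "a - b \<in> J" if "a \<in> J" "b \<in> J"
    using 1(2)[OF that(1) 1(3)[OF that(2), of "-1"]] by simp
qed

lemma complex_poly_root_exists:
  fixes p :: "complex poly"
  assumes "degree p > 0"
  obtains x where "poly p x = 0"
  using assms fundamental_theorem_of_algebra constant_degree by (metis less_irrefl)

text \<open>The pseudo-remainder of \<open>f\<close> by \<open>g\<close> lies in the ideal and, if
  nonzero, has smaller degree than \<open>g\<close>; minimality makes it vanish. The power of the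
  leading coefficient is the price of coefficients in a mere domain.\<close>

lemma ideal_least_degree_pseudo_dvd:
  fixes J :: "'a::idom poly set"
  assumes J: "is_ideal J" and g: "g \<in> J" "g \<noteq> 0"
    and min: "\<And>f. f \<in> J \<Longrightarrow> f \<noteq> 0 \<Longrightarrow> degree g \<le> degree f"
    and f: "f \<in> J"
  shows "\<exists>n q. smult (lead_coeff g ^ n) f = g * q"
proof -
  obtain q r where qr: "pseudo_divmod f g = (q, r)"
    by (cases "pseudo_divmod f g")
  note pd = pseudo_divmod[OF g(2) qr]
  have "[:lead_coeff g ^ (Suc (degree f) - degree g):] * f - q * g \<in> J"
    using J f g(1) by (intro is_idealD(3,4))
  then have "r \<in> J"
    using pd(1) by (simp add: mult.commute)
  with min pd(2) have "r = 0"
    by (meson not_le)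
  with pd(1) show ?thesis
    by auto
qed

text \<open>A nonzero member of least degree divides every member up to a nonzero constant, so a
  root of it would be a common zero. Hence it is a constant.\<close>

lemma nullstellensatz_1:
  fixes J :: "complex poly set"
  assumes J: "is_ideal J" and nz: "\<And>x. \<exists>f\<in>J. poly f x \<noteq> 0"
  shows "1 \<in> J"
proof -
  define g where "g = arg_min degree (\<lambda>f. f \<in> J \<and> f \<noteq> 0)"
  have "\<exists>f. f \<in> J \<and> f \<noteq> 0"
    using nz[of 0] by auto
  then have g: "g \<in> J" "g \<noteq> 0"
    unfolding g_def by (metis (mono_tags, lifting) arg_min_natI)+
  have min: "degree g \<le> degree f" if "f \<in> J" "f \<noteq> 0" for f
    unfolding g_def using that by (intro arg_min_nat_le) auto
  have "degree g = 0"
  proof (rule ccontr)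
    assume "degree g \<noteq> 0"
    then obtain x where x: "poly g x = 0"
      using complex_poly_root_exists by blast
    obtain f where f: "f \<in> J" "poly f x \<noteq> 0"
      using nz by blast
    obtain n q where "smult (lead_coeff g ^ n) f = g * q"
      using ideal_least_degree_pseudo_dvd[OF J g min f(1)] by blast
    from arg_cong[OF this, of "\<lambda>p. poly p x"] x f(2) g(2) show False
      by simp
  qed
  then obtain c where "g = [:c:]"
    using degree_eq_zeroE by blast
  with g is_idealD(3)[OF J g(1), of "[:inverse c:]"] show ?thesis
    by (simp add: one_pCons)
qed

text \<open>
  A nonzero element of \<open>J\<close> of least degree in \<open>y\<close> divides all others up to powers of its leading
  coefficient; so \<open>J\<close> has zeros over a general \<open>x\<close>, unless that element is a polynomial in \<open>x\<close>
  alone, and then only its finitely many roots have to be considered.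
\<close>

lemma nullstellensatz_2:
  fixes J :: "complex poly poly set"
  assumes J: "is_ideal J" and nz: "\<And>x y. \<exists>f\<in>J. poly (poly f [:y:]) x \<noteq> 0"
  shows "1 \<in> J"
proof -
  define g where "g = arg_min degree (\<lambda>f. f \<in> J \<and> f \<noteq> 0)"
  have "\<exists>f. f \<in> J \<and> f \<noteq> 0"
    using nz[of 0 0] by auto
  then have g: "g \<in> J" "g \<noteq> 0"
    unfolding g_def by (metis (mono_tags, lifting) arg_min_natI)+
  have min: "degree g \<le> degree f" if "f \<in> J" "f \<noteq> 0" for f
    unfolding g_def using that by (intro arg_min_nat_le) auto
  have ev: "poly (poly f [:y:]) x = poly (map_poly (\<lambda>p. poly p x) f) y" for f :: "complex poly poly" and x y
    by (induction f) (auto simp: map_poly_pCons)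
  have "degree g = 0"
  proof (rule ccontr)
    assume deg: "degree g \<noteq> 0"
    \<comment> \<open>Where the leading coefficient does not vanish, specializing \<open>x\<close>
      keeps the degree in \<open>y\<close>, so \<open>g\<close> has a zero over this
      \<open>x\<close>; pseudo-divisibility passes it on to all of \<open>J\<close>.\<close>
    have "lead_coeff g \<noteq> 0"
      using g(2) by simp
    then obtain x where x: "poly (lead_coeff g) x \<noteq> 0"
      using poly_all_0_iff_0 by blast
    have "degree g \<le> degree (map_poly (\<lambda>p. poly p x) g)"
      using x by (intro le_degree) (simp add: coeff_map_poly)
    with deg obtain y where "poly (map_poly (\<lambda>p. poly p x) g) y = 0"
      using complex_poly_root_exists by (metis gr_zeroI le_zero_eq)
    then have y: "poly (poly g [:y:]) x = 0"
      by (simp add: ev)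
    obtain f where f: "f \<in> J" "poly (poly f [:y:]) x \<noteq> 0"
      using nz by blast
    obtain n q where "smult (lead_coeff g ^ n) f = g * q"
      using ideal_least_degree_pseudo_dvd[OF J g min f(1)] by blast
    from arg_cong[OF this, of "\<lambda>p. poly (poly p [:y:]) x"] y f(2) x show False
      by simp
  qed
  then obtain c where c: "g = [:c:]"
    using degree_eq_zeroE by blast
  \<comment> \<open>Fixing the value \<open>x\<close> turns \<open>J\<close> into an ideal of
    one-variable polynomials without common zero, which contains 1. Lifting back, \<open>J\<close>
    has an element that is 1 modulo the linear factor at \<open>x\<close>.\<close>
  have step: "\<exists>h. 1 - [:[:-x, 1:]:] * h \<in> J" for x
  proof -
    let ?ev = "map_poly (\<lambda>p. poly p x)"
    have coeff_ev: "coeff (?ev f) n = poly (coeff f n) x" for f n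
      by (simp add: coeff_map_poly)
    have ev_add: "?ev (f + f') = ?ev f + ?ev f'" for f f'
      by (simp add: poly_eq_iff coeff_ev)
    have ev_mult: "?ev (f * f') = ?ev f * ?ev f'" for f f'
      by (simp add: poly_eq_iff coeff_ev coeff_mult poly_sum)
    have ev_const: "?ev (map_poly (\<lambda>a. [:a:]) f) = f" for f
      by (simp add: poly_eq_iff coeff_ev coeff_map_poly)
    have "is_ideal (?ev ` J)"
      unfolding is_ideal_def
    proof (intro conjI ballI allI)
      show "0 \<in> ?ev ` J"
        using is_idealD(1)[OF J] by (metis image_eqI map_poly_0)
      show "a + b \<in> ?ev ` J" if "a \<in> ?ev ` J" "b \<in> ?ev ` J" for a b
        using that is_idealD(2)[OF J] by (auto simp flip: ev_add)
      show "r * a \<in> ?ev ` J" if "a \<in> ?ev ` J" for a r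
      proof -
        from that obtain f where f: "f \<in> J" "a = ?ev f"
          by auto
        \<comment> \<open>Evaluation is surjective: \<open>r\<close> lifts to a polynomial whose
          coefficients are constant in \<open>x\<close>.\<close>
        have "r * a = ?ev (map_poly (\<lambda>a. [:a:]) r * f)"
          by (simp only: ev_mult ev_const f(2))
        with is_idealD(3)[OF J f(1)] show ?thesis
          by simp
      qed
    qed
    moreover have "\<exists>f\<in>?ev ` J. poly f y \<noteq> 0" for y
      using nz[of y x] by (auto simp: ev)
    ultimately have "1 \<in> ?ev ` J"
      by (rule nullstellensatz_1)
    then obtain f where f: "f \<in> J" "?ev f = 1"
      by force
    have "[:-x, 1:] dvd coeff (1 - f) n" for n
    proof -
      have "poly (coeff (1 - f) n) x = coeff (1 - ?ev f) n"
        by (cases n) (simp_all add: coeff_ev)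
      also have "\<dots> = 0"
        using f(2) by simp
      finally show ?thesis
        by (simp only: poly_eq_0_iff_dvd)
    qed
    then have "[:[:-x, 1:]:] dvd 1 - f"
      by (simp add: const_poly_dvd_iff)
    then obtain h where "1 - f = [:[:-x, 1:]:] * h"
      by (elim dvdE)
    then have "1 - [:[:-x, 1:]:] * h = f"
      by (simp add: algebra_simps)
    with f(1) show ?thesis
      by metis
  qed
  \<comment> \<open>Linear factors are stripped one at a time: if \<open>c = l * c'\<close> and
    \<open>1 - l * h\<close> lies in \<open>J\<close>, then so does
    \<open>c' = c' * (1 - l * h) + h * c\<close>. This ends at a nonzero constant.\<close>
  have "1 \<in> J" if "[:c:] \<in> J" "c \<noteq> 0" for c
    using that
  proof (induction "degree c" arbitrary: c)
    case 0
    then obtain a where "c = [:a:]"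
      using degree_eq_zeroE by metis
    with 0 is_idealD(3)[OF J, of "[:c:]" "[:[:inverse a:]:]"] show ?case
      by (simp add: one_pCons)
  next
    case (Suc n)
    then obtain x where "poly c x = 0"
      using complex_poly_root_exists by (metis zero_less_Suc)
    then obtain c' where c': "c = [:-x, 1:] * c'"
      by (auto simp: poly_eq_0_iff_dvd)
    with Suc.prems have "c' \<noteq> 0" by auto
    obtain h where h: "1 - [:[:-x, 1:]:] * h \<in> J"
      using step by blast
    have "[:c':] * (1 - [:[:-x, 1:]:] * h) + h * [:c:] \<in> J"
      using J h Suc.prems(1) by (intro is_idealD(2,3))
    also have "[:c:] = [:[:-x, 1:]:] * [:c':]"
      by (simp add: c')
    also have "[:c':] * (1 - [:[:-x, 1:]:] * h) + h * ([:[:-x, 1:]:] * [:c':]) = [:c':]"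
    proof -
      have "a * (1 - l * h) + h * (l * a) = a" for a l :: "complex poly poly"
        by (simp add: algebra_simps)
      then show ?thesis .
    qed
    finally have "[:c':] \<in> J" .
    moreover have "degree c = degree [:-x, 1:] + degree c'"
      unfolding c' using \<open>c' \<noteq> 0\<close> by (intro degree_mult_eq) simp_all
    then have "degree c = Suc (degree c')"
      by simp
    ultimately show ?case
      using Suc \<open>c' \<noteq> 0\<close> by simp
  qed
  with g c show ?thesis
    by auto
qed

section \<open>Zeros and common factors of polynomials in two variables\<close>

lemma nonconstant_bivariate_zero:
  fixes g :: "complex poly poly"
  assumes "\<not> is_unit g" "g \<noteq> 0"
  obtains x y where "(x, y) \<noteq> (0, 0)" "poly (poly g [:y:]) x = 0"
proof (cases "degree g = 0")
  case True
  then obtain c where c: "g = [:c:]"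
    using degree_eq_zeroE by blast
  have "degree c > 0"
  proof (rule ccontr)
    assume "\<not> degree c > 0"
    then obtain a where "c = [:a:]"
      by (metis degree_eq_zeroE neq0_conv)
    with c assms show False
      by (simp add: is_unit_const_poly_iff is_unit_pCons_iff)
  qed
  then obtain x where "poly c x = 0"
    by (rule complex_poly_root_exists)
  \<comment> \<open>The second variable does not occur in \<open>g\<close>; the value 1 keeps the
    zero away from the origin.\<close>
  with that[of x 1] c show ?thesis
    by simp
next
  case False
  have ev: "poly (poly f [:y:]) x = poly (map_poly (\<lambda>p. poly p x) f) y" for f :: "complex poly poly" and x y
    by (induction f) (auto simp: map_poly_pCons)
  \<comment> \<open>The extra factor \<open>[:0, 1:]\<close> forces \<open>x\<close> to be nonzero,
    so the zero found is not the origin.\<close>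
  have "[:0, 1:] * lead_coeff g \<noteq> 0"
    using assms(2) by simp
  then obtain x where x: "poly ([:0, 1:] * lead_coeff g) x \<noteq> 0"
    using poly_all_0_iff_0 by blast
  then have "degree g \<le> degree (map_poly (\<lambda>p. poly p x) g)"
    by (intro le_degree) (simp add: coeff_map_poly)
  with False obtain y where "poly (map_poly (\<lambda>p. poly p x) g) y = 0"
    using complex_poly_root_exists by (metis gr_zeroI le_zero_eq)
  with that[of x y] x show ?thesis
    by (simp add: ev)
qed

text \<open>If \<open>A\<close> is nonzero, it divides \<open>u * B\<close> and
  \<open>u * C\<close>, hence \<open>u\<close> times the gcd of \<open>A\<close>, \<open>B\<close>,
  \<open>C\<close>, which is a unit; \<open>t\<close> is the quotient of \<open>u\<close> by
  \<open>A\<close>.\<close>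

lemma cross_product_zero_imp_multiple:
  fixes A B C u v w :: "'a::{semiring_gcd, idom}"
  assumes gcd: "\<And>g. g dvd A \<Longrightarrow> g dvd B \<Longrightarrow> g dvd C \<Longrightarrow> is_unit g"
    and eq: "u * B = v * A" "u * C = w * A" "v * C = w * B"
  obtains t where "u = t * A" "v = t * B" "w = t * C"
proof -
  have key: "\<exists>t. u = t * A \<and> v = t * B \<and> w = t * C"
    if "A \<noteq> 0" and gcd: "\<And>g. g dvd A \<Longrightarrow> g dvd B \<Longrightarrow> g dvd C \<Longrightarrow> is_unit g"
      and eq: "u * B = v * A" "u * C = w * A" for A B C u v w :: 'a
  proof -
    have "A dvd gcd (u * B) (u * C)"
      using eq by simp
    then have "A dvd u * gcd B C"
      by (simp only: gcd_mult_left dvd_normalize_iff)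
    then have "A dvd gcd (u * A) (u * gcd B C)"
      by (intro gcd_greatest dvd_triv_right)
    then have "A dvd u * gcd A (gcd B C)"
      by (simp only: gcd_mult_left dvd_normalize_iff)
    moreover have "is_unit (gcd A (gcd B C))"
      by (rule gcd) (auto intro: dvd_trans)
    ultimately have "A dvd u"
      by (simp only: dvd_mult_unit_iff)
    then obtain t where t: "u = t * A"
      by (metis dvd_def mult.commute)
    with eq \<open>A \<noteq> 0\<close> have "v = t * B" "w = t * C"
      by (auto simp: mult_ac)
    with t show ?thesis by blast
  qed
  \<comment> \<open>Since 0 is not a unit, \<open>A\<close>, \<open>B\<close>, \<open>C\<close> are
    not all zero; permuting the roles puts a nonzero one first.\<close>
  consider "A \<noteq> 0" | "B \<noteq> 0" | "C \<noteq> 0"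
    using gcd[of 0] by force
  then show ?thesis
  proof cases
    case 1
    then show ?thesis using key[of A B C u v w] gcd eq that by blast
  next
    case 2
    then show ?thesis using key[of B A C v u w] gcd eq(1)[symmetric] eq(3) that by blast
  next
    case 3
    then show ?thesis using key[of C A B w u v] gcd eq(2,3)[symmetric] that by blast
  qed
qed

section \<open>Exactness of the Koszul complex\<close>

text \<open>Homogenization with respect to the last variable, which \<open>poly F 1\<close> sets to
  1.\<close>

lemma poly_one_surj:
  fixes p :: "complex poly poly"
  obtains F n where "homogeneous (int n) F" "poly F 1 = p"
proof -
  \<comment> \<open>One Horner step: powers of \<open>Z3\<close>, which become 1, bring both
    summands to the degree \<open>m + n + 1\<close>.\<close>
  have combine: "\<exists>F n. homogeneous (int n) F \<and> poly F 1 = a + poly M 1 * b"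
    if "\<exists>F n. homogeneous (int n) F \<and> poly F 1 = a" "\<exists>F n. homogeneous (int n) F \<and> poly F 1 = b"
      and M: "homogeneous 1 M" for a b M
  proof -
    obtain F m G n where F: "homogeneous (int m) F" "poly F 1 = a"
      and G: "homogeneous (int n) G" "poly G 1 = b"
      using \<open>\<exists>F n. homogeneous (int n) F \<and> poly F 1 = a\<close> \<open>\<exists>F n. homogeneous (int n) F \<and> poly F 1 = b\<close> by blast
    have Z: "homogeneous (int k) (Z3 ^ k)" for k
      using homogeneous_power[OF homogeneous_variables(3), of k] by simp
    have "homogeneous (int (m + n + 1)) (Z3 ^ (n + 1) * F + Z3 ^ m * (M * G))"
      using homogeneous_mult[OF Z[of "n + 1"] F(1)] homogeneous_mult[OF Z[of m] homogeneous_mult[OF M G(1)]]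
      by (intro homogeneous_add) (simp_all add: algebra_simps)
    moreover have "poly (Z3 ^ (n + 1) * F + Z3 ^ m * (M * G)) 1 = a + poly M 1 * b"
      by (simp add: F(2) G(2) Z3_def)
    ultimately show ?thesis
      by blast
  qed
  have const: "\<exists>F n. homogeneous (int n) F \<and> poly F 1 = [:q:]" for q :: "complex poly"
  proof (induction q)
    case 0
    have "homogeneous (int 0) 0 \<and> poly 0 1 = [:0::complex poly:]"
      by simp
    then show ?case by blast
  next
    case (pCons a q)
    have "homogeneous (int 0) (const3 a) \<and> poly (const3 a) 1 = [:[:a:]:]"
      using homogeneous_const3[of a] by (simp add: const3_def)
    then have "\<exists>F n. homogeneous (int n) F \<and> poly F 1 = [:[:a:]:]"
      by blast
    from combine[OF this pCons.IH homogeneous_variables(1)] show ?case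
      by (simp add: X3_def)
  qed
  have "\<exists>F n. homogeneous (int n) F \<and> poly F 1 = p"
  proof (induction p)
    case 0
    have "homogeneous (int 0) 0 \<and> poly 0 1 = (0::complex poly poly)"
      by simp
    then show ?case by blast
  next
    case (pCons a q)
    with combine[OF const[of a] pCons.IH homogeneous_variables(2)] show ?case
      by (simp add: Y3_def)
  qed
  with that show thesis by blast
qed

text \<open>In a fixed degree \<open>i\<close> and \<open>j\<close> determine \<open>k\<close>, so
  setting the last variable to 1 merges no two monomials and nothing can cancel.\<close>

lemma homogeneous_poly_one_eq_0:
  assumes "homogeneous d F" "poly F 1 = 0"
  shows "F = 0"
proof (rule form_eqI)
  fix i j k
  have "coeff3 F i j k' = 0" if "k' \<noteq> k" "coeff3 F i j k \<noteq> 0" for k'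
  proof (rule ccontr)
    assume "coeff3 F i j k' \<noteq> 0"
    with that(2) assms(1) have "int (i + j + k) = d" "int (i + j + k') = d"
      unfolding homogeneous_def by blast+
    with that(1) show False by simp
  qed
  moreover have "coeff (coeff (poly F 1) j) i = (\<Sum>k'\<le>degree F. coeff3 F i j k')"
    by (simp add: poly_altdef coeff_sum coeff3_def)
  moreover have "coeff3 F i j k = 0" if "k > degree F"
    using that by (simp add: coeff3_def coeff_eq_0)
  ultimately show "coeff3 F i j k = coeff3 0 i j k"
  proof (cases "coeff3 F i j k = 0")
    case False
    then have "k \<le> degree F"
      using \<open>k > degree F \<Longrightarrow> coeff3 F i j k = 0\<close> by force
    have "(\<Sum>k'\<le>degree F. coeff3 F i j k') = (\<Sum>k'\<in>{k}. coeff3 F i j k')"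
      using \<open>k \<le> degree F\<close> \<open>\<And>k'. k' \<noteq> k \<Longrightarrow> coeff3 F i j k \<noteq> 0 \<Longrightarrow> coeff3 F i j k' = 0\<close> False
      by (intro sum.mono_neutral_right) auto
    with \<open>coeff (coeff (poly F 1) j) i = (\<Sum>k'\<le>degree F. coeff3 F i j k')\<close> assms(2) show ?thesis
      by simp
  qed simp
qed

section \<open>Three forms without common zero\<close>

definition no_common_zero :: "form \<Rightarrow> form \<Rightarrow> form \<Rightarrow> bool" where
  "no_common_zero A B C \<longleftrightarrow>
     (\<forall>P\<in>proj_points. eval3 A P \<noteq> 0 \<or> eval3 B P \<noteq> 0 \<or> eval3 C P \<noteq> 0)"

lemma no_common_zeroD:
  assumes "no_common_zero A B C" "(x, y, z) \<noteq> (0, 0, 0)"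
  shows "\<exists>F\<in>{A, B, C}. poly (poly (poly F [:[:z:]:]) [:y:]) x \<noteq> 0"
proof -
  let ?P = "vec 3 ((!) [x, y, z])"
  have idx: "?P $ 0 = x" "?P $ 1 = y" "?P $ 2 = z"
    by (simp_all add: numeral_2_eq_2)
  have "?P \<in> carrier_vec 3"
    by simp
  moreover have "?P \<noteq> 0\<^sub>v 3"
  proof
    assume "?P = 0\<^sub>v 3"
    then have "?P $ 0 = 0" "?P $ 1 = 0" "?P $ 2 = 0"
      by simp_all
    with idx assms(2) show False by simp
  qed
  ultimately have "?P \<in> proj_points"
    by (simp add: proj_points_def)
  with assms(1) have "eval3 A ?P \<noteq> 0 \<or> eval3 B ?P \<noteq> 0 \<or> eval3 C ?P \<noteq> 0"
    unfolding no_common_zero_def by blast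
  then show ?thesis
    unfolding eval3_def idx by auto
qed

text \<open>Setting \<open>Z3\<close> to 1 in the ideal gives an ideal of bivariate polynomials
  without common zero. It contains 1, and a form that becomes 1 is a power of
  \<open>Z3\<close>.\<close>

lemma Z3_power_in_ideal:
  assumes ncz: "no_common_zero A B C"
    and hom: "homogeneous (int n) A" "homogeneous (int n) B" "homogeneous (int n) C"
  obtains N p q r where "Z3 ^ N = p * A + q * B + r * C"
proof -
  define I where "I = {p * A + q * B + r * C | p q r. True}"
  have I: "is_ideal I"
    unfolding is_ideal_def
  proof (intro conjI ballI allI)
    show "0 \<in> I"
      unfolding I_def by (rule CollectI, intro exI[of _ 0]) simp
  next
    fix a b assume "a \<in> I" "b \<in> I"
    then obtain p q r p' q' r' where "a = p * A + q * B + r * C" "b = p' * A + q' * B + r' * C"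
      unfolding I_def by blast
    then have "a + b = (p + p') * A + (q + q') * B + (r + r') * C"
      by (simp add: algebra_simps)
    then show "a + b \<in> I"
      unfolding I_def by blast
  next
    fix a s assume "a \<in> I"
    then obtain p q r where "a = p * A + q * B + r * C"
      unfolding I_def by blast
    then have "s * a = (s * p) * A + (s * q) * B + (s * r) * C"
      by (simp add: algebra_simps)
    then show "s * a \<in> I"
      unfolding I_def by blast
  qed
  have gen: "A \<in> I" "B \<in> I" "C \<in> I"
  proof -
    have "A = 1 * A + 0 * B + 0 * C" "B = 0 * A + 1 * B + 0 * C" "C = 0 * A + 0 * B + 1 * C"
      by simp_all
    then show "A \<in> I" "B \<in> I" "C \<in> I"
      unfolding I_def by blast+
  qed
  have Z: "homogeneous (int k) (Z3 ^ k)" "poly (Z3 ^ k) 1 = 1" for k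
    using homogeneous_power[OF homogeneous_variables(3), of k] by (simp_all add: Z3_def)
  \<comment> \<open>Restricting to homogeneous members allows a form to be recovered from its value
    at 1 and its degree.\<close>
  define J where "J = {poly F 1 | F. F \<in> I \<and> (\<exists>n. homogeneous (int n) F)}"
  have J: "is_ideal J"
    unfolding is_ideal_def
  proof (intro conjI ballI allI)
    show "0 \<in> J"
      unfolding J_def using is_idealD(1)[OF I] by force
  next
    fix a b assume "a \<in> J" "b \<in> J"
    then obtain F m G n where F: "F \<in> I" "homogeneous (int m) F" "a = poly F 1"
      and G: "G \<in> I" "homogeneous (int n) G" "b = poly G 1"
      unfolding J_def by blast
    \<comment> \<open>The powers of \<open>Z3\<close> equalize the degrees without changing the
      values at 1.\<close>
    let ?H = "Z3 ^ n * F + Z3 ^ m * G"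
    have "?H \<in> I"
      using I F G by (intro is_idealD(2,3))
    moreover have "homogeneous (int (m + n)) ?H"
      using homogeneous_mult[OF Z(1)[of n] F(2)] homogeneous_mult[OF Z(1)[of m] G(2)]
      by (intro homogeneous_add) (simp_all add: algebra_simps)
    moreover have "poly ?H 1 = a + b"
      using F G Z(2) by simp
    ultimately show "a + b \<in> J"
      unfolding J_def by (metis (mono_tags, lifting) mem_Collect_eq)
  next
    fix a r assume "a \<in> J"
    then obtain F m where F: "F \<in> I" "homogeneous (int m) F" "a = poly F 1"
      unfolding J_def by blast
    obtain R n where R: "homogeneous (int n) R" "poly R 1 = r"
      by (rule poly_one_surj)
    have "R * F \<in> I"
      using I F by (intro is_idealD(3))
    moreover have "homogeneous (int (n + m)) (R * F)"
      using homogeneous_mult[OF R(1) F(2)] by simp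
    moreover have "poly (R * F) 1 = r * a"
      using F R by simp
    ultimately show "r * a \<in> J"
      unfolding J_def by (metis (mono_tags, lifting) mem_Collect_eq)
  qed
  have "1 \<in> J"
  proof (rule nullstellensatz_2[OF J])
    fix x y
    obtain F where F: "F \<in> {A, B, C}" "poly (poly (poly F [:[:1:]:]) [:y:]) x \<noteq> 0"
      using no_common_zeroD[OF ncz, of x y 1] by auto
    then have "poly F 1 \<in> J"
      unfolding J_def using gen hom by blast
    with F(2) show "\<exists>f\<in>J. poly (poly f [:y:]) x \<noteq> 0"
      by (auto simp: one_pCons)
  qed
  then obtain F m where F: "F \<in> I" "homogeneous (int m) F" "poly F 1 = 1"
    unfolding J_def by auto
  have "F - Z3 ^ m = 0"
    using homogeneous_diff[OF F(2) Z(1)[of m]] F(3) Z(2)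
    by (intro homogeneous_poly_one_eq_0) simp_all
  with F(1) that show thesis
    unfolding I_def by auto
qed

text \<open>
  At \<open>z = 0\<close> the three forms have no common factor, so a relation \<open>z a = v C - w B\<close> forces
  \<open>(u, v, w)\<close> to be a multiple of \<open>(A, B, C)\<close> modulo \<open>z\<close>, and \<open>z\<close> can be cancelled.
\<close>

lemma koszul_cancel_Z3:
  assumes ncz: "no_common_zero A B C"
    and eq: "Z3 * a = v * C - w * B" "Z3 * b = w * A - u * C" "Z3 * c = u * B - v * A"
  obtains u' v' w' where "a = v' * C - w' * B" "b = w' * A - u' * C" "c = u' * B - v' * A"
proof -
  have at0: "coeff (Z3 * f) 0 = 0" for f
    by (simp add: Z3_def)
  have c0: "coeff u 0 * coeff B 0 = coeff v 0 * coeff A 0" "coeff u 0 * coeff C 0 = coeff w 0 * coeff A 0"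
    "coeff v 0 * coeff C 0 = coeff w 0 * coeff B 0"
    using eq[THEN arg_cong, of "\<lambda>f. coeff f 0"] unfolding at0 by (simp_all add: coeff_mult)
  \<comment> \<open>A non-unit common factor would vanish at some \<open>(x, y)\<close> other than
    the origin, making \<open>(x, y, 0)\<close> a common zero of \<open>A\<close>, \<open>B\<close>,
    \<open>C\<close>.\<close>
  have gcd: "is_unit g" if g: "g dvd coeff A 0" "g dvd coeff B 0" "g dvd coeff C 0" for g
  proof (rule ccontr)
    assume nu: "\<not> is_unit g"
    have ev: "poly F [:[:0:]:] = coeff F 0" for F :: form
      by (simp add: poly_0_coeff_0)
    have "g \<noteq> 0"
    proof
      assume "g = 0"
      moreover obtain F where "F \<in> {A, B, C}" "poly (poly (coeff F 0) [:0:]) 1 \<noteq> 0"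
        using no_common_zeroD[OF ncz, of 1 0 0] unfolding ev by auto
      ultimately show False
        using g by auto
    qed
    with nu obtain x y where xy: "(x, y) \<noteq> (0, 0)" "poly (poly g [:y:]) x = 0"
      by (rule nonconstant_bivariate_zero)
    then obtain F where F: "F \<in> {A, B, C}" "poly (poly (coeff F 0) [:y:]) x \<noteq> 0"
      using no_common_zeroD[OF ncz, of x y 0] unfolding ev by auto
    with g have "g dvd coeff F 0"
      by auto
    then obtain h where "coeff F 0 = g * h"
      by (elim dvdE)
    with F(2) xy(2) show False
      by simp
  qed
  obtain t where t: "coeff u 0 = t * coeff A 0" "coeff v 0 = t * coeff B 0" "coeff w 0 = t * coeff C 0"
    using cross_product_zero_imp_multiple[OF gcd c0] by blast
  define s where "s = [:t:]"
  have quot: "\<exists>f'. f = s * F + Z3 * f'" if "coeff f 0 = t * coeff F 0" for f F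
  proof -
    have "poly (f - s * F) 0 = 0"
      using that by (simp add: poly_0_coeff_0 s_def)
    then have "Z3 dvd f - s * F"
      unfolding poly_eq_0_iff_dvd Z3_def by simp
    then obtain f' where "f - s * F = Z3 * f'"
      by (elim dvdE)
    then have "f = s * F + Z3 * f'"
      by (simp only: diff_eq_eq add.commute)
    then show ?thesis ..
  qed
  obtain u' where u': "u = s * A + Z3 * u'"
    using quot[OF t(1)] by blast
  obtain v' where v': "v = s * B + Z3 * v'"
    using quot[OF t(2)] by blast
  obtain w' where w': "w = s * C + Z3 * w'"
    using quot[OF t(3)] by blast
  \<comment> \<open>The multiple \<open>s\<close> of \<open>(A, B, C)\<close> drops out of the cross
    product, leaving a factor \<open>Z3\<close> on both sides.\<close>
  have "Z3 * a = Z3 * (v' * C - w' * B)" "Z3 * b = Z3 * (w' * A - u' * C)" "Z3 * c = Z3 * (u' * B - v' * A)"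
    unfolding eq unfolding u' v' w' by (simp_all add: algebra_simps)
  moreover have "Z3 \<noteq> 0"
    by (simp add: Z3_def)
  ultimately have "a = v' * C - w' * B" "b = w' * A - u' * C" "c = u' * B - v' * A"
    by simp_all
  then show thesis
    by (rule that)
qed

text \<open>As some power of \<open>Z3\<close> is a combination of \<open>A\<close>,
  \<open>B\<close>, \<open>C\<close>, the syzygy becomes a Koszul one after multiplication by that
  power; the factors \<open>Z3\<close> are then cancelled one by one.\<close>

lemma koszul_exact:
  assumes ncz: "no_common_zero A B C"
    and hom: "homogeneous (int n) A" "homogeneous (int n) B" "homogeneous (int n) C"
    and syz: "a * A + b * B + c * C = 0"
  obtains u v w where "a = v * C - w * B" "b = w * A - u * C" "c = u * B - v * A"
proof -
  obtain N p q r where N: "Z3 ^ N = p * A + q * B + r * C"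
    by (rule Z3_power_in_ideal[OF ncz hom])
  have "\<exists>u v w. a = v * C - w * B \<and> b = w * A - u * C \<and> c = u * B - v * A"
    if "\<exists>u v w. Z3 ^ N * a = v * C - w * B \<and> Z3 ^ N * b = w * A - u * C \<and> Z3 ^ N * c = u * B - v * A" for N
    using that
  proof (induction N)
    case (Suc N)
    then obtain u v w where "Z3 ^ Suc N * a = v * C - w * B" "Z3 ^ Suc N * b = w * A - u * C"
      "Z3 ^ Suc N * c = u * B - v * A"
      by blast
    then have "Z3 * (Z3 ^ N * a) = v * C - w * B" "Z3 * (Z3 ^ N * b) = w * A - u * C"
      "Z3 * (Z3 ^ N * c) = u * B - v * A"
      by (simp_all only: power_Suc mult.assoc)
    from koszul_cancel_Z3[OF ncz this] show ?case
      by (metis Suc.IH)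
  qed simp
  \<comment> \<open>Here \<open>(u, v, w)\<close> is the cross product of \<open>(p, q, r)\<close>
    and \<open>(a, b, c)\<close>; the defect is a multiple of the given relation.\<close>
  moreover have "Z3 ^ N * a - ((r * a - p * c) * C - (p * b - q * a) * B) = p * (a * A + b * B + c * C)"
    "Z3 ^ N * b - ((p * b - q * a) * A - (q * c - r * b) * C) = q * (a * A + b * B + c * C)"
    "Z3 ^ N * c - ((q * c - r * b) * B - (r * a - p * c) * A) = r * (a * A + b * B + c * C)"
    unfolding N by (simp_all add: algebra_simps)
  then have "Z3 ^ N * a = (r * a - p * c) * C - (p * b - q * a) * B"
    "Z3 ^ N * b = (p * b - q * a) * A - (q * c - r * b) * C"
    "Z3 ^ N * c = (q * c - r * b) * B - (r * a - p * c) * A"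
    unfolding syz by simp_all
  ultimately show thesis
    using that by blast
qed

section \<open>Syzygies of products with a smooth factor\<close>

lemma eval3_simps:
  "eval3 (f + g) P = eval3 f P + eval3 g P"
  "eval3 (f * g) P = eval3 f P * eval3 g P"
  "eval3 (const3 c) P = c"
  by (simp_all add: eval3_def const3_def)

text \<open>By Euler's identity with nonzero \<open>d\<close>, a common zero of the partial
  derivatives lies on the curve and is therefore singular.\<close>

lemma smooth_no_common_zero:
  assumes "smooth_plane_curve d q"
  shows "no_common_zero (partial_x q) (partial_y q) (partial_z q)"
  unfolding no_common_zero_def
proof (rule ballI, rule ccontr)
  fix P assume P: "P \<in> proj_points"
    and "\<not> (eval3 (partial_x q) P \<noteq> 0 \<or> eval3 (partial_y q) P \<noteq> 0 \<or> eval3 (partial_z q) P \<noteq> 0)"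
  then have z: "eval3 (partial_x q) P = 0" "eval3 (partial_y q) P = 0" "eval3 (partial_z q) P = 0"
    by blast+
  have d: "d \<ge> 1" "homogeneous (int d) q"
    using assms by (simp_all add: smooth_plane_curve_def plane_curve_def)
  have "eval3 (const3 (of_nat d) * q) P = 0"
    unfolding euler_identity[OF d(2), symmetric] by (simp add: eval3_simps z)
  with d(1) have "eval3 q P = 0"
    by (simp add: eval3_simps)
  with P z have "P \<in> singular_points q"
    by (simp add: singular_points_def curve_points_def)
  with assms show False
    by (simp add: smooth_plane_curve_def)
qed

lemma no_low_degree_syzygy:
  assumes q: "smooth_plane_curve d q"
    and g: "homogeneous (int e) g" "g \<noteq> 0"
    and cop: "coprime q g"
    and hom: "homogeneous r a" "homogeneous r b" "homogeneous r c"
    and r: "r < int d - 1"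
    and syz: "a * partial_x (q * g) + b * partial_y (q * g) + c * partial_z (q * g) = 0"
  shows "a = 0 \<and> b = 0 \<and> c = 0"
proof -
  have d: "d \<ge> 1" "q \<noteq> 0" "homogeneous (int d) q"
    using q by (simp_all add: smooth_plane_curve_def plane_curve_def)
  define n where "n = d - 1"
  have n: "int d - 1 = int n"
    using d(1) by (simp add: n_def)
  note part = homogeneous_partial[OF d(3), unfolded n]
  define Dq where "Dq = a * partial_x q + b * partial_y q + c * partial_z q"
  have "Dq * g + q * (a * partial_x g + b * partial_y g + c * partial_z g) = 0"
    using syz unfolding partial_mult Dq_def by (simp add: algebra_simps)
  then have "q dvd Dq * g"
    by (metis add_eq_0_iff dvd_minus_iff dvd_triv_left)
  then have "q dvd Dq"
    using cop by (simp add: coprime_dvd_mult_left_iff)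
  then obtain h where h: "Dq = h * q"
    by (metis dvdE mult.commute)
  have "homogeneous (r + int n) (h * q)"
    unfolding h[symmetric] Dq_def
    by (intro homogeneous_add homogeneous_mult hom part)
  then have "homogeneous (r + int n - int d) h"
    using d by (intro homogeneous_factor)
  then have hh: "homogeneous (r - 1) h"
    by (simp flip: n)
  \<comment> \<open>Euler's identity reads \<open>E q = s q\<close>, so \<open>s D - h E\<close>
    kills \<open>q\<close>.\<close>
  define s where "s = const3 (of_nat d)"
  define a' where "a' = s * a - h * X3"
  define b' where "b' = s * b - h * Y3"
  define c' where "c' = s * c - h * Z3"
  have hs: "homogeneous r (s * f)" if "homogeneous r f" for f
    using homogeneous_mult[OF homogeneous_const3 that] by (simp add: s_def)
  have hom': "homogeneous r a'" "homogeneous r b'" "homogeneous r c'"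
    using homogeneous_mult[OF hh homogeneous_variables(1)] homogeneous_mult[OF hh homogeneous_variables(2)]
      homogeneous_mult[OF hh homogeneous_variables(3)]
    unfolding a'_def b'_def c'_def by (auto intro!: homogeneous_diff hs hom)
  have "a' * partial_x q + b' * partial_y q + c' * partial_z q =
      s * Dq - h * (X3 * partial_x q + Y3 * partial_y q + Z3 * partial_z q)"
    unfolding a'_def b'_def c'_def Dq_def by (simp add: algebra_simps)
  also have "\<dots> = 0"
    unfolding euler_identity[OF d(3)] h s_def by (simp add: mult_ac)
  finally have "a' * partial_x q + b' * partial_y q + c' * partial_z q = 0" .
  then obtain u v w where uvw: "a' = v * partial_z q - w * partial_y q"
    "b' = w * partial_x q - u * partial_z q" "c' = u * partial_y q - v * partial_x q"
    by (rule koszul_exact[OF smooth_no_common_zero[OF q] part])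
  have low: "f = 0" if "homogeneous r f" "f = v * F - w * G" "homogeneous (int n) F" "homogeneous (int n) G"
    for f v w F G
  proof (rule form_eqI)
    fix i j k
    show "coeff3 f i j k = coeff3 0 i j k"
    proof (rule ccontr)
      assume *: "coeff3 f i j k \<noteq> coeff3 0 i j k"
      with that(1) have "int (i + j + k) = r"
        by (simp add: homogeneous_def)
      with r n have "i + j + k < n"
        by linarith
      with * that(2-4) show False
        by (simp add: coeff3_mult_below)
    qed
  qed
  have zero: "a' = 0" "b' = 0" "c' = 0"
    by (rule low[OF hom'(1) uvw(1) part(3,2)] low[OF hom'(2) uvw(2) part(1,3)]
      low[OF hom'(3) uvw(3) part(2,1)])+
  have abc: "s * a = h * X3" "s * b = h * Y3" "s * c = h * Z3"
    using zero unfolding a'_def b'_def c'_def by simp_all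
  have f: "homogeneous (int (d + e)) (q * g)"
    using homogeneous_mult[OF d(3) g(1)] by simp
  have "s * (a * partial_x (q * g) + b * partial_y (q * g) + c * partial_z (q * g)) =
      (s * a) * partial_x (q * g) + (s * b) * partial_y (q * g) + (s * c) * partial_z (q * g)"
    by (simp only: algebra_simps)
  also have "\<dots> = h * (X3 * partial_x (q * g) + Y3 * partial_y (q * g) + Z3 * partial_z (q * g))"
    unfolding abc by (simp only: algebra_simps)
  also have "\<dots> = h * (const3 (of_nat (d + e)) * (q * g))"
    unfolding euler_identity[OF f] ..
  finally have "h * (const3 (of_nat (d + e)) * (q * g)) = 0"
    using syz by simp
  moreover have "of_nat (d + e) \<noteq> (0::complex)"
    using d(1) by (simp only: of_nat_eq_0_iff)
  ultimately have "h = 0"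
    using d(1,2) g(2) by (simp del: of_nat_add)
  moreover have "s \<noteq> 0"
    using d(1) by (simp add: s_def)
  ultimately show ?thesis
    using abc by simp
qed

lemma const3_sum: "const3 (sum h A) = (\<Sum>i\<in>A. const3 (h i))"
  by (induction A rule: infinite_finite_induct) (simp_all add: const3_simps)

lemma homogeneous_sum:
  "(\<And>i. i \<in> A \<Longrightarrow> homogeneous d (h i)) \<Longrightarrow> homogeneous d (sum h A)"
  by (induction A rule: infinite_finite_induct) (simp_all add: homogeneous_add)

lemma coeff3_sum: "coeff3 (sum h A) i j k = (\<Sum>l\<in>A. coeff3 (h l) i j k)"
  by (induction A rule: infinite_finite_induct) simp_all

lemma homogeneous_combination_const:
  assumes "homogeneous (int n) G" "\<And>l. l \<in> A \<Longrightarrow> homogeneous (int n) (F l)"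
    and G: "G = (\<Sum>l\<in>A. m l * F l)"
  shows "G = (\<Sum>l\<in>A. const3 (coeff3 (m l) 0 0 0) * F l)"
proof (rule form_eqI)
  fix i j k
  show "coeff3 G i j k = coeff3 (\<Sum>l\<in>A. const3 (coeff3 (m l) 0 0 0) * F l) i j k"
  proof (cases "i + j + k = n")
    case True
    have "coeff3 G i j k = (\<Sum>l\<in>A. coeff3 (m l * F l) i j k)"
      unfolding G by (rule coeff3_sum)
    also have "\<dots> = (\<Sum>l\<in>A. coeff3 (const3 (coeff3 (m l) 0 0 0) * F l) i j k)"
      by (intro sum.cong refl) (simp add: coeff3_mult_at[OF assms(2) True])
    finally show ?thesis
      by (simp only: coeff3_sum)
  next
    case False
    have "homogeneous (int n) (\<Sum>l\<in>A. const3 (coeff3 (m l) 0 0 0) * F l)"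
      using homogeneous_mult[OF homogeneous_const3 assms(2)] by (intro homogeneous_sum) simp
    then show ?thesis
      using homogeneous_coeff_0[OF _ False] assms(1) by metis
  qed
qed

text \<open>
  The entries of the first differential need not be the partial derivatives themselves; but in
  degree \<open>d - 1\<close> both span the ideal, so a matrix of constants relates them. It is invertible
  unless the partial derivatives are linearly dependent, which is a syzygy of degree 0.
\<close>

lemma syzygy_curve_syzygy:
  assumes "syzygy_curve d f 2 [d1, d2]"
  obtains r a b c where "r \<le> d1" "homogeneous (int r) a" "homogeneous (int r) b" "homogeneous (int r) c"
    "a * partial_x f + b * partial_y f + c * partial_z f = 0" "\<not> (a = 0 \<and> b = 0 \<and> c = 0)"
proof -
  define n where "n = d - 1"
  have d: "d \<ge> 1" "homogeneous (int d) f"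
    using assms by (simp_all add: syzygy_curve_def reduced_plane_curve_def plane_curve_def)
  then have n: "int d - 1 = int n"
    by (simp add: n_def)
  define F where "F = (!) [partial_x f, partial_y f, partial_z f]"
  have less3: "l = 0 \<or> l = 1 \<or> l = 2" if "l < 3" for l :: nat
    using that by linarith
  have sum3: "(\<Sum>l<3. h l) = h 0 + h 1 + h 2" for h :: "nat \<Rightarrow> form"
    by (simp add: numeral_3_eq_3 numeral_2_eq_2)
  have Fs: "F 0 = partial_x f" "F 1 = partial_y f" "F 2 = partial_z f"
    by (simp_all add: F_def)
  have hF: "homogeneous (int n) (F l)" if "l < 3" for l
    using less3[OF that] homogeneous_partial[OF d(2), unfolded n] by (auto simp: Fs simp flip: One_nat_def)
  from assms obtain es D1 D2 D3 where
    res: "minimal_graded_resolution (jacobian_ideal f) (replicate 3 (int d - 1))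
        (map (\<lambda>e. int d - 1 + int e) [d1, d2]) es D1 D2 D3" and es: "length es = 0"
    by (auto simp: syzygy_curve_def)
  have hom1: "graded_hom (replicate 3 (int n)) [0] D1"
    and hom2: "graded_hom [int n + int d1, int n + int d2] (replicate 3 (int n)) D2"
    and hom3: "graded_hom es [int n + int d1, int n + int d2] D3"
    and im1: "mat_image D1 = {vec 1 (\<lambda>_. g) | g. g \<in> jacobian_ideal f}"
    and im2: "mat_image D2 = mat_kernel D1" and im3: "mat_image D3 = mat_kernel D2"
    using res unfolding minimal_graded_resolution_def n by simp_all
  have D1: "D1 \<in> carrier_mat 1 3" "\<And>l. l < 3 \<Longrightarrow> homogeneous (int n) (D1 $$ (0, l))"
    using hom1 by (simp_all add: graded_hom_def)
  have D2: "D2 \<in> carrier_mat 3 2"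
    using hom2 by (simp add: graded_hom_def numeral_2_eq_2)
  have homD2: "homogeneous (int d1) (D2 $$ (l, 0))" if "l < 3" for l
  proof -
    have "\<forall>i<3. \<forall>j<2. homogeneous ([int n + int d1, int n + int d2] ! j - replicate 3 (int n) ! i) (D2 $$ (i, j))"
      using hom2 by (simp add: graded_hom_def numeral_2_eq_2)
    from this[rule_format, OF that, of 0] that show ?thesis
      by simp
  qed
  have D3: "D3 \<in> carrier_mat 2 0"
    using hom3 es by (simp add: graded_hom_def numeral_2_eq_2)
  have in_J: "g \<in> jacobian_ideal f \<longleftrightarrow> (\<exists>m. g = (\<Sum>l<3. m l * F l))" for g
  proof
    assume "g \<in> jacobian_ideal f"
    then obtain a b c where "g = a * partial_x f + b * partial_y f + c * partial_z f"
      unfolding jacobian_ideal_def by blast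
    then have "g = (\<Sum>l<3. ([a, b, c] ! l) * F l)"
      by (simp add: sum3 Fs Fs(2)[unfolded One_nat_def])
    then show "\<exists>m. g = (\<Sum>l<3. m l * F l)"
      by blast
  next
    assume "\<exists>m. g = (\<Sum>l<3. m l * F l)"
    then obtain m :: "nat \<Rightarrow> form" where "g = m 0 * partial_x f + m 1 * partial_y f + m 2 * partial_z f"
      unfolding sum3 Fs by (elim exE)
    then show "g \<in> jacobian_ideal f"
      unfolding jacobian_ideal_def by blast
  qed
  define g where "g l = D1 $$ (0, l)" for l
  have hg: "homogeneous (int n) (g l)" if "l < 3" for l
    using D1(2)[OF that] by (simp add: g_def)
  have D1v: "(D1 *\<^sub>v v) = vec 1 (\<lambda>_. \<Sum>l<3. v $ l * g l)" if "v \<in> carrier_vec 3" for v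
    using D1(1) that by (intro eq_vecI) (auto simp: scalar_prod_def g_def mult.commute atLeast0LessThan)
  have vec1: "a = b" if "vec 1 (\<lambda>_. a) = vec 1 (\<lambda>_. b)" for a b :: form
    using arg_cong[OF that, of "\<lambda>v :: form vec. v $ 0"] by simp
  have img1: "(\<Sum>l<3. v l * g l) \<in> jacobian_ideal f" for v
  proof -
    have "D1 *\<^sub>v vec 3 v \<in> mat_image D1"
      using D1(1) unfolding mat_image_def by auto
    also have "D1 *\<^sub>v vec 3 v = vec 1 (\<lambda>_. \<Sum>l<3. v l * g l)"
      by (subst D1v) simp_all
    finally show ?thesis
      unfolding im1 using vec1 by blast
  qed
  have "\<exists>m. g i = (\<Sum>l<3. const3 (m l) * F l)" if "i < 3" for i
  proof -
    have "(\<Sum>l<3. (if l = i then 1 else 0) * g l) = g i"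
      using that by (simp add: if_distrib[of "\<lambda>x. x * _"] cong: if_cong)
    then have "g i \<in> jacobian_ideal f"
      using img1[of "\<lambda>l. if l = i then 1 else 0"] by simp
    then obtain m where m: "g i = (\<Sum>l<3. m l * F l)"
      unfolding in_J ..
    show ?thesis
      by (rule exI, rule homogeneous_combination_const[OF hg[OF that] hF m]) simp
  qed
  then obtain M where M: "\<And>i. i < 3 \<Longrightarrow> g i = (\<Sum>l<3. const3 (M i l) * F l)"
    by metis
  have "\<exists>m. F i = (\<Sum>l<3. const3 (m l) * g l)" if "i < 3" for i
  proof -
    have "(\<Sum>l<3. (if l = i then 1 else 0) * F l) = F i"
      using that by (simp add: if_distrib[of "\<lambda>x. x * _"] cong: if_cong)
    then have "F i \<in> jacobian_ideal f"
      unfolding in_J by (intro exI[of _ "\<lambda>l. if l = i then 1 else 0"]) simp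
    then have "vec 1 (\<lambda>_. F i) \<in> mat_image D1"
      unfolding im1 by blast
    then obtain v where v: "v \<in> carrier_vec 3" "vec 1 (\<lambda>_. F i) = D1 *\<^sub>v v"
      using D1(1) unfolding mat_image_def by auto
    have m: "F i = (\<Sum>l<3. v $ l * g l)"
      using v(2) unfolding D1v[OF v(1)] by (rule vec1)
    show ?thesis
      by (rule exI, rule homogeneous_combination_const[OF hF[OF that] hg m]) simp
  qed
  then obtain N where N: "\<And>i. i < 3 \<Longrightarrow> F i = (\<Sum>l<3. const3 (N i l) * g l)"
    by metis
  define c where "c l = D2 $$ (l, 0)" for l
  have hc: "homogeneous (int d1) (c l)" if "l < 3" for l
    using homD2[OF that] by (simp add: c_def)
  have unit: "D2 *\<^sub>v unit_vec 2 0 = vec 3 c"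
    using D2 by (intro eq_vecI) (auto simp: c_def)
  have "vec 3 c \<in> mat_kernel D1"
    unfolding im2[symmetric] unit[symmetric] mat_image_def using D2 by auto
  then have "D1 *\<^sub>v vec 3 c = 0\<^sub>v 1"
    using D1(1) by (simp add: mat_kernel_def)
  then have "(D1 *\<^sub>v vec 3 c) $ 0 = 0"
    by simp
  then have cg: "(\<Sum>l<3. c l * g l) = 0"
    by (subst (asm) D1v) simp_all
  have c_nz: "\<exists>l<3. c l \<noteq> 0"
  proof (rule ccontr)
    assume "\<not> (\<exists>l<3. c l \<noteq> 0)"
    then have "vec 3 c = 0\<^sub>v 3"
      by (intro eq_vecI) auto
    then have "unit_vec 2 0 \<in> mat_image D3"
      unfolding im3 mat_kernel_def using D2 unit by auto
    then obtain v where "unit_vec 2 0 = D3 *\<^sub>v v" "v \<in> carrier_vec 0"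
      using D3 by (auto simp: mat_image_def)
    with D3 have "unit_vec 2 0 $ 0 = (0 :: form)"
      by (simp add: scalar_prod_def)
    then show False
      by simp
  qed
  define T where "T i l = (\<Sum>k<3. N i k * M k l)" for i l
  have T: "F i = (\<Sum>l<3. const3 (T i l) * F l)" if "i < 3" for i
  proof -
    have "F i = (\<Sum>k<3. const3 (N i k) * (\<Sum>l<3. const3 (M k l) * F l))"
      unfolding N[OF that] by (intro sum.cong refl) (simp add: M)
    also have "\<dots> = (\<Sum>k<3. \<Sum>l<3. const3 (N i k * M k l) * F l)"
      by (simp only: sum_distrib_left const3_simps mult.assoc)
    also have "\<dots> = (\<Sum>l<3. const3 (T i l) * F l)"
      unfolding T_def const3_sum sum_distrib_right by (rule sum.swap)
    finally show ?thesis .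
  qed
  show thesis
  proof (cases "\<forall>i<3. \<forall>l<3. T i l = (if i = l then 1 else 0)")
    case False
    then obtain i k where ik: "i < 3" "k < 3" "T i k \<noteq> (if i = k then 1 else 0)"
      by blast
    define t where "t l = const3 (T i l - (if i = l then 1 else 0))" for l
    have "(\<Sum>l<3. t l * F l) = (\<Sum>l<3. const3 (T i l) * F l) - (\<Sum>l<3. if i = l then F l else 0)"
      unfolding sum_subtractf[symmetric]
      by (intro sum.cong refl) (simp add: t_def const3_simps left_diff_distrib)
    also have "\<dots> = 0"
      using T[OF ik(1)] ik(1) by simp
    finally have "t 0 * partial_x f + t 1 * partial_y f + t 2 * partial_z f = 0"
      by (simp only: sum3 Fs)
    moreover have "t k \<noteq> 0"
      using ik(3) by (simp add: t_def)
    then have "\<not> (t 0 = 0 \<and> t 1 = 0 \<and> t 2 = 0)"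
      using less3[OF ik(2)] by auto
    moreover have "homogeneous (int 0) (t l)" for l
      by (simp add: t_def homogeneous_const3)
    ultimately show thesis
      using that[of 0 "t 0" "t 1" "t 2"] by simp
  next
    case True
    define matM where "matM = mat 3 3 (\<lambda>(i, j). M i j)"
    define matN where "matN = mat 3 3 (\<lambda>(i, j). N i j)"
    have carr: "matM \<in> carrier_mat 3 3" "matN \<in> carrier_mat 3 3"
      by (simp_all add: matM_def matN_def)
    have entry: "(mat 3 3 (\<lambda>(i, j). A i j) * mat 3 3 (\<lambda>(i, j). B i j)) $$ (i, k) = (\<Sum>l<3. A i l * B l k)"
      if "i < 3" "k < 3" for A B :: "nat \<Rightarrow> nat \<Rightarrow> complex" and i k
      using that by (simp add: scalar_prod_def atLeast0LessThan)
    have "matN * matM = 1\<^sub>m 3"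
    proof (rule eq_matI)
      fix i k assume "i < dim_row (1\<^sub>m 3 :: complex mat)" "k < dim_col (1\<^sub>m 3 :: complex mat)"
      then have "i < 3" "k < 3"
        by simp_all
      with True show "(matN * matM) $$ (i, k) = 1\<^sub>m 3 $$ (i, k)"
        unfolding matM_def matN_def entry[OF \<open>i < 3\<close> \<open>k < 3\<close>] by (simp add: T_def)
    qed (use carr in simp_all)
    then have "matM * matN = 1\<^sub>m 3"
      by (rule mat_mult_left_right_inverse[OF carr(2,1)])
    then have MN: "(\<Sum>l<3. M i l * N l k) = (if i = k then 1 else 0)" if "i < 3" "k < 3" for i k
      using that entry[OF that, of M N] by (simp add: matM_def matN_def)
    define a where "a l = (\<Sum>i<3. c i * const3 (M i l))" for l
    have "(\<Sum>l<3. a l * F l) = (\<Sum>l<3. \<Sum>i<3. c i * (const3 (M i l) * F l))"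
      unfolding a_def sum_distrib_right by (simp only: mult.assoc)
    also have "\<dots> = (\<Sum>i<3. \<Sum>l<3. c i * (const3 (M i l) * F l))"
      by (rule sum.swap)
    also have "\<dots> = (\<Sum>i<3. c i * g i)"
      unfolding sum_distrib_left[symmetric] by (intro sum.cong refl) (simp add: M)
    finally have "a 0 * partial_x f + a 1 * partial_y f + a 2 * partial_z f = 0"
      unfolding cg by (simp only: sum3 Fs)
    moreover have "homogeneous (int d1) (a l)" for l
      using homogeneous_mult[OF hc homogeneous_const3]
      unfolding a_def by (intro homogeneous_sum) simp
    moreover have "\<not> (a 0 = 0 \<and> a 1 = 0 \<and> a 2 = 0)"
    proof
      assume "a 0 = 0 \<and> a 1 = 0 \<and> a 2 = 0"
      then have a0: "a l = 0" if "l < 3" for l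
        using less3[OF that] by auto
      obtain k where k: "k < 3" "c k \<noteq> 0"
        using c_nz by blast
      have "(\<Sum>l<3. a l * const3 (N l k)) = (\<Sum>l<3. \<Sum>i<3. c i * const3 (M i l * N l k))"
        unfolding a_def sum_distrib_right by (simp only: const3_simps mult.assoc)
      also have "\<dots> = (\<Sum>i<3. \<Sum>l<3. c i * const3 (M i l * N l k))"
        by (rule sum.swap)
      also have "\<dots> = (\<Sum>i<3. c i * const3 (\<Sum>l<3. M i l * N l k))"
        by (simp only: sum_distrib_left const3_sum)
      also have "\<dots> = (\<Sum>i<3. if i = k then c i else 0)"
        using k(1) by (intro sum.cong refl) (simp add: MN const3_simps)
      also have "\<dots> = c k"
        using k(1) by simp
      finally show False
        using a0 k(2) by simp
    qed
    ultimately show thesis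
      using that[of d1 "a 0" "a 1" "a 2"] by simp
  qed
qed

lemma squarefree_mult_imp_coprime:
  assumes "squarefree (a * b)"
  shows "coprime a b"
proof (rule coprimeI)
  fix c assume "c dvd a" "c dvd b"
  then have "c ^ 2 dvd a * b"
    by (simp add: power2_eq_square mult_dvd_mono)
  with assms show "is_unit c"
    by (simp add: squarefree_def)
qed

theorem proposition4p4:
  shows "\<not> (\<exists>q l1 l2 :: form.
     smooth_plane_curve 4 q \<and> plane_line l1 \<and> plane_line l2 \<and>
     curve_points l1 \<noteq> curve_points l2 \<and>
     (\<forall>P \<in> singular_points (q * l1 * l2).
        node (q * l1 * l2) P \<or> tacnode (q * l1 * l2) P \<or> ordinary_triple_point (q * l1 * l2) P \<or>
        D_singularity 6 (q * l1 * l2) P \<or> A_singularity 5 (q * l1 * l2) P \<or>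
        A_singularity 7 (q * l1 * l2) P) \<and>
     free_curve (q * l1 * l2))"
proof (intro notI, elim exE conjE)
  fix q l1 l2 :: form
  assume q: "smooth_plane_curve 4 q" and "plane_line l1" "plane_line l2" and free: "free_curve (q * l1 * l2)"
  define g where "g = l1 * l2"
  have f: "q * l1 * l2 = q * g"
    by (simp add: g_def mult.assoc)
  have g: "homogeneous (int 2) g" "g \<noteq> 0"
    using \<open>plane_line l1\<close> \<open>plane_line l2\<close> homogeneous_mult[of 1 l1 1 l2]
    by (simp_all add: plane_line_def plane_curve_def g_def)
  have q': "homogeneous (int 4) q" "q \<noteq> 0"
    using q by (simp_all add: smooth_plane_curve_def plane_curve_def)
  obtain d d1 d2 where syz: "syzygy_curve d (q * g) 2 [d1, d2]" and sum: "int d1 + int d2 = int d - 1"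
    using free unfolding free_curve_def f by blast
  have hd: "homogeneous (int d) (q * g)" and "squarefree (q * g)" and "d1 \<le> d2"
    using syz by (simp_all add: syzygy_curve_def reduced_plane_curve_def plane_curve_def)
  have "homogeneous (int 4 + int 2) (q * g)"
    by (intro homogeneous_mult q' g)
  with hd have "int d = int 4 + int 2"
    by (rule homogeneous_unique_degree) (simp add: q'(2) g(2))
  with sum \<open>d1 \<le> d2\<close> have "d1 \<le> 2"
    by linarith
  obtain r a b c where r: "r \<le> d1" and abc: "homogeneous (int r) a" "homogeneous (int r) b" "homogeneous (int r) c"
    "a * partial_x (q * g) + b * partial_y (q * g) + c * partial_z (q * g) = 0" and nz: "\<not> (a = 0 \<and> b = 0 \<and> c = 0)"
    by (rule syzygy_curve_syzygy[OF syz])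
  have "int r < int 4 - 1"
    using r \<open>d1 \<le> 2\<close> by simp
  from no_low_degree_syzygy[OF q g squarefree_mult_imp_coprime[OF \<open>squarefree (q * g)\<close>] abc(1-3) this abc(4)] nz
  show False by blast
qed

end
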